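(* Consider the two-weight OWNM problem with $U\ge 3$. Then the algorithm Two-Weight-Matching (\textsc{Twm}) has competitive ratio at least $1/3$; that is, there is a constant $c$ such that $\textsc{Twm}(I)\ge \tfrac13\,\textsc{OPT}(I)-c$ for every input $I$.
   Context: Online Weighted Non-Crossing Matching (OWNM): the input is a sequence $p_1,\dots,p_{2n}$ of points in the Euclidean plane in general position, revealed online one at a time; when $p_i$ arrives its weight $w(p_i)>0$ is revealed. Upon arrival of $p_i$ an online algorithm must irrevocably either leave $p_i$ unmatched or match it with a previously arrived, currently unmatched point $p_j$, subject to the constraint that the straight-line segments joining matched pairs are pairwise non-crossing. The profit $\textsc{ALG}(I)$ is the total weight of matched points. $\textsc{OPT}(I)=\sum_i w(p_i)$ (a perfect non-crossing matching always exists). A deterministic algorithm is $\rho$-competitive if there is a constant $c$ with $\textsc{ALG}(I)\ge\rho\,\textsc{OPT}(I)-c$ for all inputs $I$; its competitive ratio is the supremum of such $\rho$. In the two-weight OWNM, every weight is either $1$ or $U$, where $U>1$ is known to the algorithm. Algorithm \textsc{Twm}: all points lie in a bounding box $B$. The algorithm maintains a partition of $B$ into convex regions, initially the single region $B$, and matches two points only if they lie in the same region. When two points in a region $R$ are matched, the segment between them is extended to the boundary of $R$, splitting $R$ into two convex regions. When a point $p$ arrives in a region $R$ containing some unmatched points: (1) if $w(p)=U$, $p$ is matched with an unmatched point of largest weight in $R$; (2) if $w(p)=1$ and $R$ contains an unmatched point of weight $U$, $p$ is matched with that point; (3) otherwise ($p$ and all unmatched points of $R$ have weight $1$), $p$ is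 matched with an unmatched point $q$ of $R$ if this can be done so that neither of the two new regions ends up empty (each contains an unmatched point); otherwise $p$ is left unmatched. If $R$ contains no unmatched point, $p$ is left unmatched. *)

theory Defs
  imports "HOL-Analysis.Analysis"
begin

type_synonym point = "real ^ 2"
type_synonym wpoint = "point \<times> real"

text \<open>Instances: a bounding box together with the weighted points in order of arrival.\<close>

type_synonym inst = "point set \<times> wpoint list"

definition general_position :: "point set \<Rightarrow> bool" where
  "general_position P \<longleftrightarrow>
     (\<forall>a\<in>P. \<forall>b\<in>P. \<forall>c\<in>P. a \<noteq> b \<and> a \<noteq> c \<and> b \<noteq> c \<longrightarrow> \<not> collinear {a, b, c})"

definition two_weight_instances :: "real \<Rightarrow> inst set" where
  "two_weight_instances U =
     {(B, ps). (\<exists>a b. B = cbox a b) \<and> fst ` set ps \<subseteq> B \<and>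
        (\<exists>n. length ps = 2 * n) \<and> distinct (map fst ps) \<and> general_position (fst ` set ps) \<and>
        snd ` set ps \<subseteq> {1, U}}"

text \<open>
  A deterministic online algorithm receives the bounding box, the previously arrived points
  (most recent first) and the newly arrived point, and returns the earlier point to be matched
  with the new one, if any. Any internal state of the algorithm is a function of these data.
\<close>

type_synonym algorithm = "point set \<Rightarrow> wpoint list \<Rightarrow> wpoint \<Rightarrow> wpoint option"

primrec run :: "algorithm \<Rightarrow> point set \<Rightarrow> wpoint list \<Rightarrow> (wpoint \<times> wpoint) set" where
  "run A B [] = {}"
| "run A B (p # past) = run A B past \<union>
     (case A B past p of None \<Rightarrow> {} | Some q \<Rightarrow> {(q, p)})"

definition matching :: "algorithm \<Rightarrow> inst \<Rightarrow> (wpoint \<times> wpoint) set" where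
  "matching A I = (case I of (B, ps) \<Rightarrow> run A B (rev ps))"

definition noncrossing_matching :: "wpoint list \<Rightarrow> (wpoint \<times> wpoint) set \<Rightarrow> bool" where
  "noncrossing_matching ps M \<longleftrightarrow>
     (\<forall>(p, q)\<in>M. p \<in> set ps \<and> q \<in> set ps \<and> p \<noteq> q) \<and>
     (\<forall>(p, q)\<in>M. \<forall>(p', q')\<in>M. (p, q) \<noteq> (p', q') \<longrightarrow>
        {p, q} \<inter> {p', q'} = {} \<and>
        closed_segment (fst p) (fst q) \<inter> closed_segment (fst p') (fst q') = {})"

text \<open>The choices of an algorithm are legal if they always produce a non-crossing matching
  that joins the arriving point to an earlier one; run only grows, so feasibility of the final
  matching entails feasibility at every intermediate time.\<close>

definition ownm_algorithm :: "inst set \<Rightarrow> algorithm \<Rightarrow> bool" where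
  "ownm_algorithm \<I> A \<longleftrightarrow>
     (\<forall>(B, ps)\<in>\<I>.
        noncrossing_matching ps (matching A (B, ps)) \<and>
        (\<forall>i<length ps. \<forall>q. A B (rev (take i ps)) (ps ! i) = Some q \<longrightarrow> q \<in> set (take i ps)))"

definition profit :: "algorithm \<Rightarrow> inst \<Rightarrow> real" where
  "profit A I = (\<Sum>p \<in> fst ` matching A I \<union> snd ` matching A I. snd p)"

definition OPT :: "inst \<Rightarrow> real" where
  "OPT I = (\<Sum>p\<leftarrow>snd I. snd p)"

definition competitive :: "inst set \<Rightarrow> algorithm \<Rightarrow> real \<Rightarrow> bool" where
  "competitive \<I> A \<rho> \<longleftrightarrow> (\<exists>c. \<forall>I\<in>\<I>. profit A I \<ge> \<rho> * OPT I - c)"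

definition competitive_ratio :: "inst set \<Rightarrow> algorithm \<Rightarrow> ereal" where
  "competitive_ratio \<I> A = Sup {ereal \<rho> | \<rho>. competitive \<I> A \<rho>}"


text \<open>The open half-plane to the left of the directed line from \<open>a\<close> to \<open>b\<close>.\<close>

definition left_side :: "point \<Rightarrow> point \<Rightarrow> point set" where
  "left_side a b = {x. (b$1 - a$1) * (x$2 - a$2) - (b$2 - a$2) * (x$1 - a$1) > 0}"

text \<open>
  Regions do not contain the extended segments that cut them out. By general position, no
  later point lies on such a segment, so the regions partition all that matters of the box.
\<close>

definition split_region :: "point set \<Rightarrow> point \<Rightarrow> point \<Rightarrow> point set set" where
  "split_region R a b = {R \<inter> left_side a b, R \<inter> left_side b a}"

text \<open>State of the algorithm: the current regions and the unmatched points.\<close>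

type_synonym twm_state = "point set set \<times> wpoint set"

definition region_of :: "twm_state \<Rightarrow> point \<Rightarrow> point set" where
  "region_of s x = (THE R. R \<in> fst s \<and> x \<in> R)"

definition unmatched_in :: "twm_state \<Rightarrow> point set \<Rightarrow> wpoint set" where
  "unmatched_in s R = {q \<in> snd s. fst q \<in> R}"

text \<open>The points with which the rules allow the arriving point \<open>p\<close> to be matched.\<close>

definition twm_candidates :: "real \<Rightarrow> twm_state \<Rightarrow> wpoint \<Rightarrow> wpoint set" where
  "twm_candidates U s p =
     (let R = region_of s (fst p); V = unmatched_in s R in
      if snd p = U then {q \<in> V. \<forall>r\<in>V. snd r \<le> snd q}
      else if \<exists>q\<in>V. snd q = U then {q \<in> V. snd q = U}
      else {q \<in> V. \<forall>S\<in>split_region R (fst p) (fst q). \<exists>r\<in>V - {q}. fst r \<in> S})"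

text \<open>
  The rules leave open which of several candidates is taken. This is resolved by an arbitrary
  rule that may depend on everything the algorithm has seen so far.
\<close>

type_synonym tie_rule = "point set \<Rightarrow> wpoint list \<Rightarrow> wpoint \<Rightarrow> wpoint set \<Rightarrow> wpoint"

definition tie_breaking :: "tie_rule \<Rightarrow> bool" where
  "tie_breaking t \<longleftrightarrow> (\<forall>B past p C. C \<noteq> {} \<longrightarrow> t B past p C \<in> C)"

definition twm_choice ::
  "real \<Rightarrow> tie_rule \<Rightarrow> point set \<Rightarrow> wpoint list \<Rightarrow> twm_state \<Rightarrow> wpoint \<Rightarrow> wpoint option" where
  "twm_choice U t B past s p =
     (let C = twm_candidates U s p in if C = {} then None else Some (t B past p C))"

definition twm_update :: "twm_state \<Rightarrow> wpoint \<Rightarrow> wpoint option \<Rightarrow> twm_state" where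
  "twm_update s p d =
     (case d of
        None \<Rightarrow> (fst s, insert p (snd s))
      | Some q \<Rightarrow>
          (let R = region_of s (fst p)
           in (fst s - {R} \<union> split_region R (fst p) (fst q), snd s - {q})))"

primrec twm_state :: "real \<Rightarrow> tie_rule \<Rightarrow> point set \<Rightarrow> wpoint list \<Rightarrow> twm_state" where
  "twm_state U t B [] = ({B}, {})"
| "twm_state U t B (p # past) =
     (let s = twm_state U t B past in twm_update s p (twm_choice U t B past s p))"

definition Twm :: "real \<Rightarrow> tie_rule \<Rightarrow> algorithm" where
  "Twm U t = (\<lambda>B past p. twm_choice U t B past (twm_state U t B past) p)"

end

theory Submission
  imports Defs
begin

text \<open>
  A region never holds more than three unmatched points: an unmatched point of weight \<open>U\<close> is
  alone in its region, and among any three points of weight 1 one is a legal partner for a new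
  point of weight 1. Charge \<open>3\<close> to every region holding an unmatched point of weight 1 and \<open>U\<close>
  to every other region. The charge bounds the unmatched weight, does not increase when a point
  is left unmatched, and increases by at most twice the weight of the matched pair otherwise:
  a pair of weight at least \<open>U + 1\<close> leaves two regions of charge at most \<open>U\<close>, while a pair of
  weight \<open>2\<close> replaces a charge of \<open>3\<close> by \<open>3 + 3\<close>. So the unmatched weight is at most
  twice the profit plus \<open>U\<close>.
\<close>

section \<open>Sides of a line\<close>

text \<open>Twice the signed area of the triangle \<open>a b x\<close>: the sign tells on which side
  of the directed line \<open>x\<close> lies.\<close>

definition orient :: "point \<Rightarrow> point \<Rightarrow> point \<Rightarrow> real" where
  "orient a b x = (b$1 - a$1) * (x$2 - a$2) - (b$2 - a$2) * (x$1 - a$1)"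

lemma mem_left_side: "x \<in> left_side a b \<longleftrightarrow> 0 < orient a b x"
  by (simp add: left_side_def orient_def)

lemma orient_swap: "orient b a x = - orient a b x"
  by (simp add: orient_def algebra_simps)

lemma orient_rotate: "orient a x b = - orient a b x"
  by (simp add: orient_def algebra_simps)

lemma orient_self [simp]: "orient a b a = 0" "orient a b b = 0"
  by (simp_all add: orient_def)

text \<open>As a function of its last argument \<open>orient a b\<close> is affine. Convexity of
  half-planes and vanishing on the segment both rest on this.\<close>

lemma orient_convex_comb:
  "u + v = 1 \<Longrightarrow> orient a b (u *\<^sub>R x + v *\<^sub>R y) = u * orient a b x + v * orient a b y"
proof -
  assume "u + v = 1"
  then have v: "v = 1 - u" by simp
  show ?thesis unfolding v by (simp add: orient_def algebra_simps)
qed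

lemma convex_left_side: "convex (left_side a b)"
proof (rule convexI)
  fix x y :: point and u v :: real
  assume "x \<in> left_side a b" "y \<in> left_side a b" "0 \<le> u" "0 \<le> v" and uv: "u + v = 1"
  then have "0 < u * orient a b x + v * orient a b y"
    unfolding mem_left_side
    by (metis add_nonneg_pos add_pos_nonneg less_eq_real_def mult_nonneg_nonneg mult_pos_pos
        zero_less_one add.right_neutral)
  then show "u *\<^sub>R x + v *\<^sub>R y \<in> left_side a b"
    by (simp add: mem_left_side orient_convex_comb[OF uv])
qed

lemma left_side_disjoint: "left_side a b \<inter> left_side b a = {}"
  by (auto simp: mem_left_side orient_swap[of b a])

lemma orient_segment: "x \<in> closed_segment a b \<Longrightarrow> orient a b x = 0"
  by (auto simp: closed_segment_def orient_convex_comb)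

lemma orient_zero_imp_collinear:
  assumes "orient a b x = 0" "a \<noteq> b"
  shows "collinear {a, b, x}"
proof -
  have e: "(b$1 - a$1) * (x$2 - a$2) = (b$2 - a$2) * (x$1 - a$1)"
    using assms(1) by (simp add: orient_def)
  \<comment> \<open>The scalar is a quotient of differences in a coordinate where \<open>a\<close>
    and \<open>b\<close> differ; the case split finds such a coordinate.\<close>
  have "\<exists>c. x - a = c *\<^sub>R (b - a)"
  proof (cases "b$1 = a$1")
    case True
    then have "b$2 - a$2 \<noteq> 0" using assms(2) by (simp add: vec_eq_iff forall_2)
    with True e show ?thesis
      by (intro exI[of _ "(x$2 - a$2) / (b$2 - a$2)"]) (simp add: vec_eq_iff forall_2)
  next
    case False
    then have "x$2 - a$2 = (x$1 - a$1) / (b$1 - a$1) * (b$2 - a$2)"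
      using e by (simp add: eq_divide_eq mult.commute)
    with False show ?thesis
      by (intro exI[of _ "(x$1 - a$1) / (b$1 - a$1)"]) (simp add: vec_eq_iff forall_2)
  qed
  then have "collinear {0, b - a, x - a}"
    by (auto simp: collinear_lemma)
  then have "collinear {b, a, x}"
    by (simp add: collinear_3[of b a x])
  then show ?thesis by (simp add: insert_commute)
qed

text \<open>With \<open>P\<close> the whole input, this keeps every other input point off an
  extended segment, so cutting a region into two open sides loses none of them.\<close>

lemma orient_nonzero:
  assumes "general_position P" "{a, b, x} \<subseteq> P" "a \<noteq> b" "a \<noteq> x" "b \<noteq> x"
  shows "orient a b x \<noteq> 0"
  using assms orient_zero_imp_collinear[of a b x] unfolding general_position_def by blast

text \<open>If each line through \<open>p\<close> left the other two points on one side, the signs of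
  \<open>orient p\<close> would contradict its antisymmetry.\<close>

lemma separating_line:
  assumes gp: "general_position P" "{p, a, b, c} \<subseteq> P" and d: "distinct [p, a, b, c]"
  shows "\<exists>q\<in>{a, b, c}. (\<exists>r\<in>{a, b, c}. r \<in> left_side p q) \<and>
                         (\<exists>r\<in>{a, b, c}. r \<in> left_side q p)"
proof -
  have nz: "orient p a b \<noteq> 0" "orient p a c \<noteq> 0" "orient p b c \<noteq> 0"
    using gp d by (simp_all add: orient_nonzero[of P])
  have s: "orient p b a = - orient p a b" "orient p c a = - orient p a c"
    "orient p c b = - orient p b c" by (rule orient_rotate)+
  \<comment> \<open>The cases say that the line from \<open>p\<close> through \<open>a\<close>,
    \<open>b\<close> or \<open>c\<close> separates the other two points; antisymmetry flips the sign
    in the middle one. If all failed, the product of the three expressions would be negative, yet it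
    is a square.\<close>
  consider "orient p a b * orient p a c < 0" | "orient p a b * orient p b c > 0"
    | "orient p a c * orient p b c < 0"
    using nz by (fastforce simp: mult_less_0_iff zero_less_mult_iff)
  then show ?thesis
  proof cases
    case 1
    then show ?thesis
      by (intro bexI[of _ a]) (auto simp: mem_left_side orient_swap[of a p] mult_less_0_iff)
  next
    case 2
    then show ?thesis using s
      by (intro bexI[of _ b]) (auto simp: mem_left_side orient_swap[of b p] zero_less_mult_iff)
  next
    case 3
    then show ?thesis using s
      by (intro bexI[of _ c]) (auto simp: mem_left_side orient_swap[of c p] mult_less_0_iff)
  qed
qed

section \<open>One step of the algorithm\<close>

text \<open>An empty region costs \<open>U\<close> as well, so that a lone point of weight
  \<open>U\<close> can be left there without raising the charge.\<close>

definition charge :: "real \<Rightarrow> wpoint set \<Rightarrow> real" where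
  "charge U V = (if \<exists>q\<in>V. snd q = 1 then 3 else U)"

text \<open>The second alternative admits a lone point of weight \<open>U\<close>. The condition
  passes to subsets, so both halves of a cut region inherit it.\<close>

definition sparse :: "wpoint set \<Rightarrow> bool" where
  "sparse V \<longleftrightarrow> finite V \<and> (card V \<le> 3 \<and> (\<forall>q\<in>V. snd q = 1) \<or> card V \<le> 1)"

lemma sparse_mono: "sparse V \<Longrightarrow> W \<subseteq> V \<Longrightarrow> sparse W"
  unfolding sparse_def using card_mono[of V W] finite_subset[of W V]
  by (meson le_trans subsetD)

lemma charge_eq_3: "q \<in> V \<Longrightarrow> snd q = 1 \<Longrightarrow> charge U V = 3"
  unfolding charge_def by metis

lemma charge_bounds:
  assumes "U \<ge> 3"
  shows "3 \<le> charge U V" "charge U V \<le> U"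
  using assms by (simp_all add: charge_def)

text \<open>This fixes the constant 3 in \<open>charge\<close>: several points in a sparse set are
  at most three points of weight 1, and a lone point weighs 1 or \<open>U\<close>.\<close>

lemma weight_le_charge:
  assumes "sparse V" "U \<ge> 3" "snd ` V \<subseteq> {1, U}"
  shows "(\<Sum>q\<in>V. snd q) \<le> charge U V"
proof (cases "card V \<le> 1")
  case True
  then have "V = {} \<or> (\<exists>q. V = {q})"
    using assms(1) by (metis One_nat_def card_1_singletonE card_0_eq le_Suc_eq le_zero_eq sparse_def)
  then show ?thesis using assms(2,3) by (auto simp: charge_def)
next
  case False
  then have V: "card V \<le> 3" "\<forall>q\<in>V. snd q = 1" using assms(1) by (auto simp: sparse_def)
  then have "(\<Sum>q\<in>V. snd q) = real (card V)" by simp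
  with V False show ?thesis by (cases "V = {}") (auto simp: charge_def)
qed

text \<open>\<open>X\<close> is the whole input, including points still to arrive, since a cut must
  avoid those too.\<close>

locale weighted_points =
  fixes U :: real and X :: "wpoint set"
  assumes U: "U \<ge> 3"
    and inj: "inj_on fst X"
    and gp: "general_position (fst ` X)"
    and weights: "snd ` X \<subseteq> {1, U}"
begin

lemma weight_cases: "q \<in> X \<Longrightarrow> snd q = 1 \<or> snd q = U"
  using weights by auto

lemma fst_neq: "p \<in> X \<Longrightarrow> q \<in> X \<Longrightarrow> p \<noteq> q \<Longrightarrow> fst p \<noteq> fst q"
  using inj by (auto dest: inj_onD)

text \<open>The first two rules never fail in an occupied region, so only the third can. By
  \<open>separating_line\<close> it succeeds as soon as there are three points. The bound 2 leaves
  room for \<open>p\<close> itself.\<close>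

lemma candidates_nonempty:
  assumes V: "V \<subseteq> X" "sparse V" "V \<noteq> {}" and p: "p \<in> X" "p \<notin> V"
    and VR: "V = unmatched_in s (region_of s (fst p))"
    and empty: "twm_candidates U s p = {}"
  shows "snd p = 1 \<and> (\<forall>q\<in>V. snd q = 1) \<and> card V \<le> 2"
proof -
  have fin: "finite V" using V by (simp add: sparse_def)
  let ?R = "region_of s (fst p)"
  have C: "twm_candidates U s p =
     (if snd p = U then {q \<in> V. \<forall>r\<in>V. snd r \<le> snd q}
      else if \<exists>q\<in>V. snd q = U then {q \<in> V. snd q = U}
      else {q \<in> V. \<forall>S\<in>split_region ?R (fst p) (fst q). \<exists>r\<in>V - {q}. fst r \<in> S})"
    by (simp add: twm_candidates_def VR Let_def)
  have "snd p \<noteq> U"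
  proof
    assume "snd p = U"
    obtain m where "m \<in> V" "\<forall>r\<in>V. snd r \<le> snd m"
      using fin V(3) Max_in[of "snd ` V"] Max_ge[of "snd ` V"] by fastforce
    then have "m \<in> twm_candidates U s p" unfolding C using \<open>snd p = U\<close> by simp
    with empty show False by simp
  qed
  moreover have noU: "\<not> (\<exists>q\<in>V. snd q = U)"
    using empty C \<open>snd p \<noteq> U\<close> by (auto split: if_splits)
  moreover have "card V \<le> 2"
  proof (rule ccontr)
    assume "\<not> card V \<le> 2"
    then have "3 \<le> card V" by simp
    then obtain T where T: "T \<subseteq> V" "card T = 3" by (meson obtain_subset_with_card_n)
    then obtain a b c where abc: "T = {a, b, c}" "a \<noteq> b" "a \<noteq> c" "b \<noteq> c"
      by (auto simp: card_3_iff)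
    have inX: "a \<in> X" "b \<in> X" "c \<in> X" and ne: "p \<noteq> a" "p \<noteq> b" "p \<noteq> c" using abc T V p by auto
    have fd: "distinct [fst p, fst a, fst b, fst c]"
      using inX ne abc p by (simp add: fst_neq)
    have "\<exists>q\<in>fst ` {a, b, c}.
        (\<exists>r\<in>fst ` {a, b, c}. r \<in> left_side (fst p) q) \<and>
        (\<exists>r\<in>fst ` {a, b, c}. r \<in> left_side q (fst p))"
      using inX p separating_line[OF gp _ fd] by simp
    then obtain q r r' where q: "q \<in> {a, b, c}" and r: "r \<in> {a, b, c}" "r' \<in> {a, b, c}"
      and sides: "fst r \<in> left_side (fst p) (fst q)" "fst r' \<in> left_side (fst q) (fst p)"
      by blast
    \<comment> \<open>The rule asks for witnesses other than \<open>q\<close>; here they are,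
      because \<open>q\<close> lies on the cutting line and \<open>r\<close>, \<open>r'\<close> do
      not.\<close>
    then have "r \<noteq> q" "r' \<noteq> q" by (auto simp: mem_left_side)
    then have "r \<in> V - {q}" "r' \<in> V - {q}" using r abc T by auto
    moreover have "fst x \<in> ?R" if "x \<in> V" for x
      using that by (subst (asm) VR) (simp add: unmatched_in_def)
    ultimately have "\<forall>S\<in>split_region ?R (fst p) (fst q). \<exists>x\<in>V - {q}. fst x \<in> S"
      using sides by (auto simp: split_region_def)
    moreover have "q \<in> V" using q abc T by auto
    ultimately have "q \<in> twm_candidates U s p"
      unfolding C using \<open>snd p \<noteq> U\<close> noU by simp
    with empty show False by simp
  qed
  moreover have "\<forall>q\<in>V. snd q = 1" using noU V(1) weight_cases by blast
  ultimately show ?thesis using weight_cases[OF p(1)] by auto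
qed

text \<open>An empty region already costs \<open>U\<close>, the maximum. In an occupied one all
  points, including \<open>p\<close>, have weight 1, so the charge is 3 before and after.\<close>

lemma charge_skip:
  assumes V: "V \<subseteq> X" "sparse V" and p: "p \<in> X" "p \<notin> V"
    and VR: "V = unmatched_in s (region_of s (fst p))"
    and empty: "twm_candidates U s p = {}"
  shows "sparse (insert p V) \<and> charge U (insert p V) \<le> charge U V"
proof (cases "V = {}")
  case True
  then show ?thesis using U by (simp add: sparse_def charge_def)
next
  case False
  then show ?thesis using candidates_nonempty[OF V False p VR empty] V p
    by (auto simp: sparse_def charge_def)
qed

lemma charge_match:
  assumes V: "V \<subseteq> X" and p: "p \<in> X"
    and VR: "V = unmatched_in s R" "R = region_of s (fst p)"
    and q: "q \<in> twm_candidates U s p"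
    and S: "S = R \<inter> left_side (fst p) (fst q)" "S' = R \<inter> left_side (fst q) (fst p)"
  shows "charge U {r \<in> V - {q}. fst r \<in> S} + charge U {r \<in> V - {q}. fst r \<in> S'}
    \<le> charge U V + 2 * (snd p + snd q)"
proof (cases "snd p = U \<or> snd q = U")
  case True
  have "q \<in> V" using q VR by (auto simp: twm_candidates_def Let_def split: if_splits)
  then have "q \<in> X" using V by blast
  then have "snd p + snd q \<ge> U + 1"
    using True U weight_cases[OF p] weight_cases[of q] by auto
  \<comment> \<open>Whatever the halves contain, they cost at most \<open>2 * U\<close>, which is
    below \<open>2 * (U + 1)\<close>.\<close>
  moreover have "charge U W + charge U W' \<le> charge U V + 2 * w" if "w \<ge> U + 1" for W W' w
    using that charge_bounds[OF U, of V] charge_bounds(2)[OF U, of W]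
      charge_bounds(2)[OF U, of W'] by linarith
  ultimately show ?thesis by blast
next
  case False
  \<comment> \<open>A point of weight \<open>U\<close> in the region would have triggered the second
    rule and made \<open>snd q = U\<close>. Hence the third rule was applied.\<close>
  then have noU: "\<not> (\<exists>q\<in>V. snd q = U)"
    using q VR by (auto simp: twm_candidates_def Let_def split: if_splits)
  then have "q \<in> V" and both: "\<forall>S\<in>split_region R (fst p) (fst q). \<exists>r\<in>V - {q}. fst r \<in> S"
    using False q VR by (auto simp: twm_candidates_def Let_def split: if_splits)
  have one: "\<forall>q\<in>V. snd q = 1" using noU V weight_cases by blast
  \<comment> \<open>The third rule leaves a point of weight 1 in each half, so neither half becomes
    an empty region of charge \<open>U\<close>. The sum 6 is then within 3 + 4.\<close>
  obtain r r' where "r \<in> {r \<in> V - {q}. fst r \<in> S}" "r' \<in> {r \<in> V - {q}. fst r \<in> S'}"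
    using both by (auto simp: split_region_def S)
  then have "charge U {r \<in> V - {q}. fst r \<in> S} = 3" "charge U {r \<in> V - {q}. fst r \<in> S'} = 3"
    using one charge_eq_3[of r] charge_eq_3[of r'] by simp_all
  moreover have "snd p = 1" "snd q = 1" using False one \<open>q \<in> V\<close> weight_cases[OF p] by auto
  moreover have "charge U V = 3" using one \<open>q \<in> V\<close> charge_eq_3[of q] by simp
  ultimately show ?thesis by simp
qed

end

section \<open>The invariant\<close>

lemma noncrossing_matching_iff:
  "noncrossing_matching ps M \<longleftrightarrow>
     (\<forall>a b. (a, b) \<in> M \<longrightarrow> a \<in> set ps \<and> b \<in> set ps \<and> a \<noteq> b) \<and>
     (\<forall>a b c d. (a, b) \<in> M \<longrightarrow> (c, d) \<in> M \<longrightarrow> (a, b) \<noteq> (c, d) \<longrightarrow>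
        {a, b} \<inter> {c, d} = {} \<and>
        closed_segment (fst a) (fst b) \<inter> closed_segment (fst c) (fst d) = {})"
  unfolding noncrossing_matching_def by fast

abbreviation matched :: "(wpoint \<times> wpoint) set \<Rightarrow> wpoint set" where
  "matched M \<equiv> fst ` M \<union> snd ` M"

text \<open>\<open>covered\<close> includes future points; matched points are exempt since by
  \<open>segments\<close> they lie in no region. Disjointness makes \<open>region_of\<close>
  meaningful, and \<open>segments\<close> with convexity prevents later crossings.\<close>

locale twm_invariant = weighted_points +
  fixes past :: "wpoint list" and s :: twm_state and M :: "(wpoint \<times> wpoint) set"
  assumes past_X: "set past \<subseteq> X"
    and finite_regions: "finite (fst s)"
    and convex_regions: "R \<in> fst s \<Longrightarrow> convex R"
    and disjoint_regions: "R \<in> fst s \<Longrightarrow> R' \<in> fst s \<Longrightarrow> R \<noteq> R' \<Longrightarrow> R \<inter> R' = {}"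
    and matched_past: "matched M \<subseteq> set past"
    and unmatched: "snd s = set past - matched M"
    and covered: "x \<in> X - matched M \<Longrightarrow> \<exists>R\<in>fst s. fst x \<in> R"
    and segments: "(a, b) \<in> M \<Longrightarrow> R \<in> fst s \<Longrightarrow> closed_segment (fst a) (fst b) \<inter> R = {}"
    and noncrossing: "noncrossing_matching past M"
    and sparse: "R \<in> fst s \<Longrightarrow> sparse (unmatched_in s R)"
    and charges: "(\<Sum>R\<in>fst s. charge U (unmatched_in s R)) \<le> 2 * (\<Sum>q\<in>matched M. snd q) + U"
begin

lemma region_of_eq:
  assumes "R \<in> fst s" "x \<in> R"
  shows "region_of s x = R"
  unfolding region_of_def
proof (rule the_equality)
  show "R' = R" if "R' \<in> fst s \<and> x \<in> R'" for R'
    using that assms disjoint_regions[of R' R] by auto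
qed (use assms in simp)

text \<open>The regions partition the unmatched points, so \<open>weight_le_charge\<close> can be
  summed over them.\<close>

lemma unmatched_weight:
  "(\<Sum>q\<in>snd s. snd q) \<le> 2 * (\<Sum>q\<in>matched M. snd q) + U"
proof -
  have fin: "finite (snd s)" by (simp add: unmatched)
  have "snd s = (\<Union>R\<in>fst s. unmatched_in s R)"
  proof
    show "snd s \<subseteq> (\<Union>R\<in>fst s. unmatched_in s R)"
    proof
      fix q assume q: "q \<in> snd s"
      then have "q \<in> X - matched M" using past_X unmatched by blast
      from covered[OF this] q show "q \<in> (\<Union>R\<in>fst s. unmatched_in s R)"
        by (auto simp: unmatched_in_def)
    qed
  qed (auto simp: unmatched_in_def)
  then have "(\<Sum>q\<in>snd s. snd q) = (\<Sum>q\<in>(\<Union>R\<in>fst s. unmatched_in s R). snd q)" by simp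
  also have "\<dots> = (\<Sum>R\<in>fst s. \<Sum>q\<in>unmatched_in s R. snd q)"
    using disjoint_regions fin finite_regions
    by (intro sum.UNION_disjoint) (auto simp: unmatched_in_def)
  also have "\<dots> \<le> (\<Sum>R\<in>fst s. charge U (unmatched_in s R))"
    using past_X weights unmatched
    by (intro sum_mono weight_le_charge sparse U) (fastforce simp: unmatched_in_def)+
  finally show ?thesis using charges by simp
qed

text \<open>The regions stay and, by disjointness, only the contents of the one around
  \<open>p\<close> change; \<open>charge_skip\<close> handles that one.\<close>

lemma skip:
  assumes p: "p \<in> X" "p \<notin> set past" and empty: "twm_candidates U s p = {}"
  shows "twm_invariant U X (p # past) (fst s, insert p (snd s)) M"
proof -
  let ?s' = "(fst s, insert p (snd s))"
  have pM: "p \<notin> matched M" using matched_past p by auto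
  obtain R where R: "R \<in> fst s" "fst p \<in> R" using covered[of p] p pM by auto
  have Req: "region_of s (fst p) = R" using region_of_eq R by simp
  let ?V = "unmatched_in s R"
  have V: "?V \<subseteq> X" "p \<notin> ?V" using past_X p by (auto simp: unmatched_in_def unmatched)
  have step: "sparse (insert p ?V) \<and> charge U (insert p ?V) \<le> charge U ?V"
    using V p R sparse empty by (intro charge_skip[of _ p s]) (auto simp: Req)
  have new: "unmatched_in ?s' R = insert p ?V" using R by (auto simp: unmatched_in_def)
  have old: "unmatched_in ?s' R' = unmatched_in s R'" if "R' \<in> fst s" "R' \<noteq> R" for R'
    using disjoint_regions[of R' R] that R by (auto simp: unmatched_in_def)
  have le: "charge U (unmatched_in ?s' R') \<le> charge U (unmatched_in s R')" if "R' \<in> fst s" for R'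
    using that old new step by (cases "R' = R") auto
  show ?thesis
  proof unfold_locales
    show "set (p # past) \<subseteq> X" "matched M \<subseteq> set (p # past)"
      using past_X p matched_past by auto
    show "finite (fst ?s')" using finite_regions by simp
    show "convex R'" if "R' \<in> fst ?s'" for R' using that convex_regions by simp
    show "R1 \<inter> R2 = {}" if "R1 \<in> fst ?s'" "R2 \<in> fst ?s'" "R1 \<noteq> R2" for R1 R2
      using that disjoint_regions by simp
    show "snd ?s' = set (p # past) - matched M" using unmatched pM by auto
    show "\<exists>R\<in>fst ?s'. fst x \<in> R" if "x \<in> X - matched M" for x using covered that by simp
    show "closed_segment (fst a) (fst b) \<inter> R' = {}" if "(a, b) \<in> M" "R' \<in> fst ?s'" for a b R'
      using segments that by simp
    show "noncrossing_matching (p # past) M"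
      using noncrossing by (fastforce simp: noncrossing_matching_def)
    show "sparse (unmatched_in ?s' R')" if "R' \<in> fst ?s'" for R'
      using that old new step sparse by (cases "R' = R") auto
    have "(\<Sum>R\<in>fst ?s'. charge U (unmatched_in ?s' R)) \<le> (\<Sum>R\<in>fst s. charge U (unmatched_in s R))"
      by (simp add: sum_mono le)
    then show "(\<Sum>R\<in>fst ?s'. charge U (unmatched_in ?s' R)) \<le> 2 * (\<Sum>q\<in>matched M. snd q) + U"
      using charges by simp
  qed
qed

lemma candidate_unmatched:
  assumes "q \<in> twm_candidates U s p"
  shows "q \<in> unmatched_in s (region_of s (fst p))"
  using assms by (auto simp: twm_candidates_def Let_def split: if_splits)

text \<open>By disjointness the other regions keep their contents, and \<open>charge_match\<close>
  pays for replacing \<open>R\<close> by its halves.\<close>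

lemma match:
  assumes p: "p \<in> X" "p \<notin> set past" and q: "q \<in> twm_candidates U s p"
    and R_def: "R = region_of s (fst p)"
  shows "twm_invariant U X (p # past)
    (fst s - {R} \<union> split_region R (fst p) (fst q), snd s - {q}) (insert (q, p) M)"
proof -
  let ?s' = "(fst s - {R} \<union> split_region R (fst p) (fst q), snd s - {q})"
  let ?M' = "insert (q, p) M"
  let ?V = "unmatched_in s R"
  define S where "S = R \<inter> left_side (fst p) (fst q)"
  define S' where "S' = R \<inter> left_side (fst q) (fst p)"
  have split: "split_region R (fst p) (fst q) = {S, S'}"
    by (simp add: split_region_def S_def S'_def)
  have pM: "p \<notin> matched M" using matched_past p by auto
  obtain R0 where "R0 \<in> fst s" "fst p \<in> R0" using covered[of p] p pM by auto
  then have R: "R \<in> fst s" "fst p \<in> R" using region_of_eq R_def by auto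
  have qV: "q \<in> ?V" using candidate_unmatched[OF q] R_def by simp
  then have qs: "q \<in> snd s" and qR: "fst q \<in> R" by (auto simp: unmatched_in_def)
  have qpast: "q \<in> set past" and qM: "q \<notin> matched M" using qs unmatched by auto
  have qX: "q \<in> X" and qp: "q \<noteq> p" using qpast past_X p by auto
  have fqp: "fst q \<noteq> fst p" using fst_neq qX qp p by simp
  have VX: "?V \<subseteq> X" using past_X by (auto simp: unmatched_in_def unmatched)
  have SR: "S \<subseteq> R" "S' \<subseteq> R" by (auto simp: S_def S'_def)
  \<comment> \<open>Convexity keeps the new segment inside \<open>R\<close>, which all old segments
    avoid. Being on the cutting line, it also misses both open halves.\<close>
  have seg: "closed_segment (fst q) (fst p) \<subseteq> R"
    using convex_regions[OF R(1)] R(2) qR by (simp add: closed_segment_subset)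
  have newseg: "closed_segment (fst q) (fst p) \<inter> S = {}" "closed_segment (fst q) (fst p) \<inter> S' = {}"
    using orient_segment orient_swap[of "fst p" "fst q"]
    by (fastforce simp: S_def S'_def mem_left_side)+
  have oldseg: "closed_segment (fst a) (fst b) \<inter> closed_segment (fst q) (fst p) = {}"
    if "(a, b) \<in> M" for a b using segments[OF that R(1)] seg by blast
  have old: "unmatched_in ?s' R' = unmatched_in s R'" if "R' \<in> fst s - {R}" for R'
    using disjoint_regions[of R' R] that R qR by (auto simp: unmatched_in_def)
  have new: "unmatched_in ?s' S = {r \<in> ?V - {q}. fst r \<in> S}"
    "unmatched_in ?s' S' = {r \<in> ?V - {q}. fst r \<in> S'}"
    using SR by (auto simp: unmatched_in_def)
  have SS: "S \<inter> S' = {}" using left_side_disjoint by (auto simp: S_def S'_def)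
  show ?thesis
  proof unfold_locales
    show "set (p # past) \<subseteq> X" "matched ?M' \<subseteq> set (p # past)"
      using past_X p matched_past qpast by auto
    show "finite (fst ?s')" using finite_regions by (simp add: split)
    show "convex R'" if "R' \<in> fst ?s'" for R'
      using that convex_regions R by (auto simp: split S_def S'_def convex_Int convex_left_side)
    show "R1 \<inter> R2 = {}" if "R1 \<in> fst ?s'" "R2 \<in> fst ?s'" "R1 \<noteq> R2" for R1 R2
    proof -
      have other: "R' \<inter> S = {}" "R' \<inter> S' = {}" if "R' \<in> fst s - {R}" for R'
        using that disjoint_regions[of R' R] R SR by auto
      have "R1 \<in> fst s - {R} \<or> R1 = S \<or> R1 = S'" "R2 \<in> fst s - {R} \<or> R2 = S \<or> R2 = S'"
        using that by (auto simp: split)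
      then show ?thesis
        using that(3) other[of R1] other[of R2] SS disjoint_regions[of R1 R2]
        by (elim disjE) (auto simp: Int_commute)
    qed
    show "snd ?s' = set (p # past) - matched ?M'" using unmatched p by auto
    show "\<exists>R\<in>fst ?s'. fst x \<in> R" if x: "x \<in> X - matched ?M'" for x
    proof -
      obtain R' where R': "R' \<in> fst s" "fst x \<in> R'" using covered[of x] x by auto
      show ?thesis
      proof (cases "R' = R")
        case True
        \<comment> \<open>As \<open>x\<close> is not matched by \<open>?M'\<close>, it differs from
          \<open>p\<close> and \<open>q\<close>; general position puts it strictly on one
          side.\<close>
        have "orient (fst p) (fst q) (fst x) \<noteq> 0"
          using x p qX fqp fst_neq[of p x] fst_neq[of q x]
          by (intro orient_nonzero[OF gp]) auto
        then have "fst x \<in> S \<or> fst x \<in> S'"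
          using True R' orient_swap[of "fst q" "fst p" "fst x"]
          by (auto simp: S_def S'_def mem_left_side)
        then show ?thesis by (auto simp: split)
      qed (use R' in auto)
    qed
    show "closed_segment (fst a) (fst b) \<inter> R' = {}" if ab: "(a, b) \<in> ?M'" "R' \<in> fst ?s'" for a b R'
    proof -
      consider "(a, b) \<in> M" "R' \<in> fst s" | "(a, b) \<in> M" "R' \<subseteq> R"
        | "(a, b) = (q, p)" "R' \<in> fst s - {R}" | "(a, b) = (q, p)" "R' = S \<or> R' = S'"
        using ab SR by (auto simp: split)
      then show ?thesis
      proof cases
        case 1
        then show ?thesis using segments by simp
      next
        case 2
        then show ?thesis using segments[OF _ R(1)] by blast
      next
        case 3
        then have "R \<inter> R' = {}" using disjoint_regions[of R R'] R by auto
        with 3 seg show ?thesis by auto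
      next
        case 4
        then show ?thesis using newseg by auto
      qed
    qed
    have ends: "{a, b} \<inter> {q, p} = {}" if "(a, b) \<in> M" for a b
      using that qM pM by (force simp: image_iff)
    show "noncrossing_matching (p # past) ?M'"
      unfolding noncrossing_matching_iff
    proof (rule conjI; intro allI impI)
      fix a b assume "(a, b) \<in> ?M'"
      then consider "(a, b) \<in> M" | "a = q" "b = p" by auto
      then show "a \<in> set (p # past) \<and> b \<in> set (p # past) \<and> a \<noteq> b"
      proof cases
        case 1
        then have "a \<in> set past \<and> b \<in> set past \<and> a \<noteq> b"
          using noncrossing unfolding noncrossing_matching_iff by blast
        then show ?thesis by simp
      next
        case 2
        then show ?thesis using qpast qp by simp
      qed
    next
      fix a b c d assume ab: "(a, b) \<in> ?M'" and cd: "(c, d) \<in> ?M'" and ne: "(a, b) \<noteq> (c, d)"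
      consider "(a, b) \<in> M" "(c, d) \<in> M" | "(a, b) \<in> M" "(c, d) = (q, p)"
        | "(a, b) = (q, p)" "(c, d) \<in> M" using ab cd ne by auto
      then show "{a, b} \<inter> {c, d} = {} \<and>
          closed_segment (fst a) (fst b) \<inter> closed_segment (fst c) (fst d) = {}"
      proof cases
        case 1
        then show ?thesis using noncrossing ne unfolding noncrossing_matching_iff by blast
      next
        case 2
        then show ?thesis using ends[of a b] oldseg[of a b] by auto
      next
        case 3
        then show ?thesis using ends[of c d] oldseg[of c d] by auto
      qed
    qed
    show "sparse (unmatched_in ?s' R')" if "R' \<in> fst ?s'" for R'
    proof -
      have "R' \<in> fst s - {R} \<or> R' = S \<or> R' = S'" using that by (auto simp: split)
      then show ?thesis
      proof (elim disjE)
        assume "R' = S" then show ?thesis using new sparse_mono[OF sparse[OF R(1)]] by auto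
      next
        assume "R' = S'" then show ?thesis using new sparse_mono[OF sparse[OF R(1)]] by auto
      qed (use old sparse in auto)
    qed
    let ?f = "\<lambda>R. charge U (unmatched_in s R)" and ?f' = "\<lambda>R. charge U (unmatched_in ?s' R)"
    have pos: "0 \<le> ?f' R" for R
      using charge_bounds(1)[OF U, of "unmatched_in ?s' R"] by simp
    have fin: "finite (matched M)" using matched_past finite_subset by blast
    \<comment> \<open>Only an inequality: the regions form a set, so an empty half may coincide with
      the other half or with an older empty region and is then counted once. Nonnegative charges
      make this harmless.\<close>
    have "sum ?f' (fst ?s') \<le> sum ?f' (fst s - {R}) + sum ?f' {S, S'}"
      using finite_regions sum_nonneg[of "(fst s - {R}) \<inter> {S, S'}" ?f'] pos
      by (subst fst_conv, subst split, subst sum_Un) simp_all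
    also have "sum ?f' (fst s - {R}) = sum ?f (fst s - {R})"
      using old by (intro sum.cong) auto
    also have "sum ?f' {S, S'} \<le> ?f' S + ?f' S'"
      using pos by (cases "S = S'") auto
    also have "\<dots> \<le> ?f R + 2 * (snd p + snd q)"
      unfolding new using charge_match[OF VX p(1) refl R_def q S_def S'_def] .
    also have "sum ?f (fst s - {R}) + (?f R + 2 * (snd p + snd q))
        = sum ?f (fst s) + 2 * (snd p + snd q)"
      using sum.remove[OF finite_regions R(1), of ?f] by simp
    also have "\<dots> \<le> 2 * (sum snd (matched M) + snd p + snd q) + U" using charges by simp
    also have "sum snd (matched M) + snd p + snd q = sum snd (matched ?M')"
      using fin pM qM qp by simp
    finally show "sum ?f' (fst ?s') \<le> 2 * sum snd (matched ?M') + U" by simp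
  qed
qed

end

section \<open>Whole runs: the invariant by induction on arrivals, legality, and the ratio\<close>

context weighted_points
begin

lemma twm_invariant:
  assumes t: "tie_breaking t" and B: "convex B" "fst ` X \<subseteq> B"
  shows "set past \<subseteq> X \<Longrightarrow> distinct past \<Longrightarrow>
    twm_invariant U X past (twm_state U t B past) (run (Twm U t) B past)"
proof (induction past)
  case Nil
  \<comment> \<open>The only region is the empty box, whose charge is the additive \<open>U\<close>
    of the invariant.\<close>
  show ?case
    using B U by unfold_locales
      (auto simp: noncrossing_matching_def unmatched_in_def sparse_def charge_def)
next
  case (Cons p past)
  let ?s = "twm_state U t B past" and ?M = "run (Twm U t) B past"
  interpret I: twm_invariant U X past ?s ?M using Cons by simp
  let ?C = "twm_candidates U ?s p"
  have p: "p \<in> X" "p \<notin> set past" using Cons.prems by auto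
  show ?case
  proof (cases "?C = {}")
    case True
    then show ?thesis using I.skip[OF p True]
      by (simp add: Twm_def twm_choice_def twm_update_def Let_def)
  next
    case False
    then have "t B past p ?C \<in> ?C" using t unfolding tie_breaking_def by blast
    from I.match[OF p this refl] False show ?thesis
      by (simp add: Twm_def twm_choice_def twm_update_def Let_def)
  qed
qed

end

text \<open>Stated for every prefix, with the full input as \<open>X\<close>, because legality
  constrains each intermediate choice.\<close>

lemma twm_run_invariant:
  assumes "U \<ge> 3" "tie_breaking t" "(B, ps) \<in> two_weight_instances U" "i \<le> length ps"
  shows "twm_invariant U (set ps) (rev (take i ps)) (twm_state U t B (rev (take i ps)))
    (run (Twm U t) B (rev (take i ps)))"
proof -
  have I: "\<exists>a b. B = cbox a b" "fst ` set ps \<subseteq> B" "distinct (map fst ps)"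
    "general_position (fst ` set ps)" "snd ` set ps \<subseteq> {1, U}"
    using assms(3) by (auto simp: two_weight_instances_def)
  interpret weighted_points U "set ps"
    using I assms(1) by unfold_locales (auto simp: distinct_map)
  show ?thesis
    using I assms(2) set_take_subset[of i ps]
    by (intro twm_invariant) (auto simp: distinct_map)
qed

text \<open>Non-crossing is read off the invariant at the end. That partners arrived earlier needs
  it at each prefix, where candidates are unmatched points of that prefix.\<close>

lemma twm_legal:
  assumes "U \<ge> 3" "tie_breaking t"
  shows "ownm_algorithm (two_weight_instances U) (Twm U t)"
  unfolding ownm_algorithm_def
proof clarify
  fix B ps assume I: "(B, ps) \<in> two_weight_instances U"
  interpret full: twm_invariant U "set ps" "rev ps" "twm_state U t B (rev ps)"
    "run (Twm U t) B (rev ps)"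
    using twm_run_invariant[OF assms I order.refl] by simp
  have "noncrossing_matching ps (matching (Twm U t) (B, ps))"
    using full.noncrossing by (simp add: noncrossing_matching_def matching_def)
  moreover have "q \<in> set (take i ps)"
    if i: "i < length ps" and q: "Twm U t B (rev (take i ps)) (ps ! i) = Some q" for i q
  proof -
    let ?s = "twm_state U t B (rev (take i ps))"
    interpret prefix: twm_invariant U "set ps" "rev (take i ps)" ?s
      "run (Twm U t) B (rev (take i ps))"
      using twm_run_invariant[OF assms I] i by simp
    let ?C = "twm_candidates U ?s (ps ! i)"
    have "?C \<noteq> {}" "q = t B (rev (take i ps)) (ps ! i) ?C"
      using q by (simp_all add: Twm_def twm_choice_def Let_def split: if_splits)
    then have "q \<in> ?C" using assms(2) unfolding tie_breaking_def by blast
    from prefix.candidate_unmatched[OF this] show ?thesis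
      by (simp add: unmatched_in_def prefix.unmatched)
  qed
  ultimately show "noncrossing_matching ps (matching (Twm U t) (B, ps)) \<and>
    (\<forall>i<length ps. \<forall>q. Twm U t B (rev (take i ps)) (ps ! i) = Some q \<longrightarrow> q \<in> set (take i ps))"
    by blast
qed

lemma twm_profit:
  assumes "U \<ge> 3" "tie_breaking t" "I \<in> two_weight_instances U"
  shows "profit (Twm U t) I \<ge> 1 / 3 * OPT I - U / 3"
proof -
  obtain B ps where I: "I = (B, ps)" by (cases I)
  let ?M = "run (Twm U t) B (rev ps)"
  interpret twm_invariant U "set ps" "rev ps" "twm_state U t B (rev ps)" ?M
    using twm_run_invariant[OF assms(1,2) assms(3)[unfolded I] order.refl] by simp
  have "distinct ps" using assms(3) by (simp add: I two_weight_instances_def distinct_map)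
  then have "OPT I = sum snd (set ps)" by (simp add: I OPT_def sum_list_distinct_conv_sum_set)
  also have "\<dots> = sum snd (set ps - matched ?M) + sum snd (matched ?M)"
    using matched_past by (intro sum.subset_diff) auto
  \<comment> \<open>Unmatched weight is at most twice the matched weight plus \<open>U\<close>; the
    matched weight itself makes the factor 3. Division by 3 gives the constant
    \<open>U / 3\<close>.\<close>
  also have "\<dots> \<le> 3 * sum snd (matched ?M) + U"
    using unmatched_weight by (simp add: unmatched)
  also have "sum snd (matched ?M) = profit (Twm U t) I"
    by (simp add: I profit_def matching_def)
  finally show ?thesis by simp
qed

theorem theorem1:
  fixes U :: real and t :: tie_rule
  assumes "U \<ge> 3"
    and "tie_breaking t"
  shows "ownm_algorithm (two_weight_instances U) (Twm U t) \<and>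
         competitive_ratio (two_weight_instances U) (Twm U t) \<ge> ereal (1 / 3) \<and>
         (\<exists>c. \<forall>I \<in> two_weight_instances U. profit (Twm U t) I \<ge> 1 / 3 * OPT I - c)"
proof -
  have c: "\<exists>c. \<forall>I \<in> two_weight_instances U. profit (Twm U t) I \<ge> 1 / 3 * OPT I - c"
    using twm_profit[OF assms] by blast
  then have "competitive (two_weight_instances U) (Twm U t) (1 / 3)"
    by (simp add: competitive_def)
  then have "ereal (1 / 3) \<le> competitive_ratio (two_weight_instances U) (Twm U t)"
    unfolding competitive_ratio_def by (intro Sup_upper) blast
  with c twm_legal[OF assms] show ?thesis by blast
qed

end
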